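(* Every graph with diameter two has a terminal set.
   Context: All graphs are simple and undirected. A set $S \subseteq V(G)$ is in general position if no shortest path of $G$ contains three vertices of $S$. A terminal set of $G$ is a general position set $S$ that is maximal under inclusion and such that for every vertex $u \in V(G)\setminus S$ there is a shortest path of $G$ with $u$ as an endpoint that contains at least two vertices of $S$. *)

theory Defs
  imports "Graph_Theory.Graph_Theory"
begin

text \<open>
  Undirected graphs are symmetric digraphs, as in the library locale \<^locale>\<open>graph\<close>, but
  neither the vertex set nor the arc set is required to be finite.
\<close>
locale simple_graph = loopfree_digraph + nomulti_digraph + sym_digraph

context wf_digraph
begin

definition graph_dist :: "'a \<Rightarrow> 'a \<Rightarrow> ereal" where
  "graph_dist u v = \<mu> (\<lambda>_. 1) u v"

text \<open>
  Vertices in different components have distance \<open>\<infinity>\<close>, so a graph of finite diameter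
  is connected.
\<close>
definition graph_diameter :: ereal where
  "graph_diameter = (SUP (u, v) \<in> verts G \<times> verts G. graph_dist u v)"

definition shortest_path :: "'a \<Rightarrow> 'b awalk \<Rightarrow> 'a \<Rightarrow> bool" where
  "shortest_path u p v \<longleftrightarrow> apath u p v \<and> ereal (real (length p)) = graph_dist u v"

definition general_position :: "'a set \<Rightarrow> bool" where
  "general_position S \<longleftrightarrow> S \<subseteq> verts G \<and>
     \<not> (\<exists>u p v. shortest_path u p v \<and> 3 \<le> card (S \<inter> set (awalk_verts u p)))"

text \<open>
  In a symmetric digraph the reverse of a shortest path is a shortest path on the same vertices,
  so a path with \<open>u\<close> as an endpoint may be taken to start in \<open>u\<close>.
\<close>
definition terminal_set :: "'a set \<Rightarrow> bool" where
  "terminal_set S \<longleftrightarrow> general_position S \<and>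
     (\<forall>T. general_position T \<and> S \<subseteq> T \<longrightarrow> T = S) \<and>
     (\<forall>u \<in> verts G - S. \<exists>p v. shortest_path u p v \<and> 2 \<le> card (S \<inter> set (awalk_verts u p)))"

end

end

theory Submission
  imports Defs
begin

text \<open>
  In a graph of diameter two, shortest paths have at most three vertices, so a set is in general
  position as soon as adjacency is transitive on it, i.e. as soon as it induces a disjoint union of
  cliques. Such a set is terminal if every vertex \<open>u\<close> outside it is the endpoint of
  an induced path \<open>u, a, b\<close> with \<open>a\<close> and \<open>b\<close> in the set.
  Collect cliques greedily: given the cliques chosen so far, add a maximal clique of the subgraph
  induced by the vertices that have no neighbour among them. A vertex \<open>u\<close> left out at the end
  has a neighbour in some chosen clique; in the first such clique it also has a non-neighbour,
  because that clique was maximal in a subgraph containing \<open>u\<close>.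
  The invariant \<open>greedy_set\<close> passes to unions of chains, so Zorn's lemma
  replaces the transfinite iteration when the graph is infinite.
\<close>

context simple_graph
begin

section \<open>Disjoint unions of cliques and the greedy invariant\<close>

definition clique :: "'a set \<Rightarrow> bool" where
  "clique K \<longleftrightarrow> (\<forall>x\<in>K. \<forall>y\<in>K. x \<noteq> y \<longrightarrow> x \<rightarrow>\<^bsub>G\<^esub> y)"

text \<open>Since adjacency is symmetric and irreflexive, dropping \<open>x \<noteq> z\<close> would
  force a loop at each end of an edge inside \<open>S\<close>.\<close>

definition cluster_set :: "'a set \<Rightarrow> bool" where
  "cluster_set S \<longleftrightarrow> S \<subseteq> verts G \<and>
     (\<forall>x\<in>S. \<forall>y\<in>S. \<forall>z\<in>S. x \<rightarrow>\<^bsub>G\<^esub> y \<longrightarrow> y \<rightarrow>\<^bsub>G\<^esub> z \<longrightarrow> x \<noteq> z \<longrightarrow> x \<rightarrow>\<^bsub>G\<^esub> z)"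

definition ends_induced_path :: "'a set \<Rightarrow> 'a \<Rightarrow> bool" where
  "ends_induced_path S u \<longleftrightarrow>
     (\<exists>a\<in>S. \<exists>b\<in>S. u \<rightarrow>\<^bsub>G\<^esub> a \<and> a \<rightarrow>\<^bsub>G\<^esub> b \<and> u \<noteq> b \<and> \<not> u \<rightarrow>\<^bsub>G\<^esub> b)"

text \<open>Only vertices with a neighbour in \<open>S\<close> are constrained, so that intermediate
  stages of the construction, including the empty set, qualify.\<close>

definition greedy_set :: "'a set \<Rightarrow> bool" where
  "greedy_set S \<longleftrightarrow> cluster_set S \<and>
     (\<forall>u \<in> verts G - S. (\<exists>a\<in>S. u \<rightarrow>\<^bsub>G\<^esub> a) \<longrightarrow> ends_induced_path S u)"

section \<open>Construction of a maximal greedy set\<close>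

lemma adj_sym: "x \<rightarrow>\<^bsub>G\<^esub> y \<Longrightarrow> y \<rightarrow>\<^bsub>G\<^esub> x"
  using arcs_ends_symmetric[OF sym_arcs] .

lemma adj_irrefl: "\<not> x \<rightarrow>\<^bsub>G\<^esub> x"
  by (auto simp: arcs_ends_conv dest: no_loops)

text \<open>Zorn's lemma on the cliques inside \<open>U\<close>: a vertex of \<open>U - K\<close>
  adjacent to all of \<open>K\<close> could be added to \<open>K\<close>.\<close>

lemma exists_maximal_clique:
  assumes "v \<in> U"
  obtains K where "K \<subseteq> U" "clique K" "K \<noteq> {}"
    "\<And>u. u \<in> U - K \<Longrightarrow> \<exists>b\<in>K. \<not> u \<rightarrow>\<^bsub>G\<^esub> b"
proof -
  let ?A = "{K. K \<subseteq> U \<and> clique K}"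
  have "\<exists>K\<in>?A. \<forall>X\<in>?A. K \<subseteq> X \<longrightarrow> X = K"
  proof (rule subset_Zorn_nonempty)
    show "?A \<noteq> {}" by (auto simp: clique_def)
    fix C assume ne: "C \<noteq> {}" and ch: "subset.chain ?A C"
    have sub: "K \<subseteq> U" "clique K" if "K \<in> C" for K
      using ch that by (auto simp: subset_chain_def)
    have "clique (\<Union>C)"
      unfolding clique_def
    proof (intro ballI impI)
      fix x y assume "x \<in> \<Union>C" "y \<in> \<Union>C" "x \<noteq> y"
      then obtain K L where KL: "x \<in> K" "K \<in> C" "y \<in> L" "L \<in> C" by blast
      then have "K \<subseteq> L \<or> L \<subseteq> K" using ch by (auto simp: subset_chain_def)
      then show "x \<rightarrow>\<^bsub>G\<^esub> y" using KL sub(2) \<open>x \<noteq> y\<close> unfolding clique_def by blast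
    qed
    then show "\<Union>C \<in> ?A" using sub(1) by blast
  qed
  then obtain K where K: "K \<subseteq> U" "clique K"
    and max: "\<And>X. X \<subseteq> U \<Longrightarrow> clique X \<Longrightarrow> K \<subseteq> X \<Longrightarrow> X = K" by fastforce
  have non: "\<exists>b\<in>K. \<not> u \<rightarrow>\<^bsub>G\<^esub> b" if "u \<in> U - K" for u
  proof (rule ccontr)
    assume "\<not> (\<exists>b\<in>K. \<not> u \<rightarrow>\<^bsub>G\<^esub> b)"
    then have "clique (insert u K)" using K(2) adj_sym unfolding clique_def by blast
    then have "insert u K = K" using K(1) that by (intro max) auto
    then show False using that by blast
  qed
  \<comment> \<open>If \<open>K\<close> were empty, \<open>non\<close> at the given vertex
    \<open>v\<close> would produce an element of \<open>K\<close>.\<close>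
  have "K \<noteq> {}" using non assms by blast
  then show thesis using that K non by blast
qed

lemma greedy_set_extend:
  assumes S: "greedy_set S" and v: "v \<in> verts G - S" "\<And>a. a \<in> S \<Longrightarrow> \<not> v \<rightarrow>\<^bsub>G\<^esub> a"
  obtains T where "greedy_set T" "S \<subset> T"
proof -
  define U where "U = {u \<in> verts G - S. \<forall>a\<in>S. \<not> u \<rightarrow>\<^bsub>G\<^esub> a}"
  have "v \<in> U" using v by (auto simp: U_def)
  then obtain K where K: "K \<subseteq> U" "clique K" "K \<noteq> {}"
    and max: "\<And>u. u \<in> U - K \<Longrightarrow> \<exists>b\<in>K. \<not> u \<rightarrow>\<^bsub>G\<^esub> b"
    using exists_maximal_clique by metis
  have sep: "\<not> x \<rightarrow>\<^bsub>G\<^esub> y" "\<not> y \<rightarrow>\<^bsub>G\<^esub> x" if "x \<in> K" "y \<in> S" for x y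
    using K(1) that adj_sym unfolding U_def by blast+
  have "cluster_set (S \<union> K)"
    unfolding cluster_set_def
  proof (intro conjI ballI impI)
    show "S \<union> K \<subseteq> verts G"
      using S K(1) by (auto simp: greedy_set_def cluster_set_def U_def)
  next
    fix x y z assume xyz: "x \<in> S \<union> K" "y \<in> S \<union> K" "z \<in> S \<union> K"
      and adj: "x \<rightarrow>\<^bsub>G\<^esub> y" "y \<rightarrow>\<^bsub>G\<^esub> z" "x \<noteq> z"
    \<comment> \<open>By \<open>sep\<close> no edge joins \<open>S\<close> and \<open>K\<close>, so
      consecutive vertices lie on the same side.\<close>
    consider "x \<in> S" "y \<in> S" "z \<in> S" | "x \<in> K" "z \<in> K"
      using xyz adj sep by (metis Un_iff)
    then show "x \<rightarrow>\<^bsub>G\<^esub> z"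
    proof cases
      case 1
      then show ?thesis using S adj unfolding greedy_set_def cluster_set_def by blast
    next
      case 2
      then show ?thesis using K(2) adj(3) unfolding clique_def by blast
    qed
  qed
  moreover have "ends_induced_path (S \<union> K) u"
    if u: "u \<in> verts G - (S \<union> K)" and a: "a \<in> S \<union> K" "u \<rightarrow>\<^bsub>G\<^esub> a" for u a
  \<comment> \<open>A path that already exists in \<open>S\<close> survives the enlargement.
    Otherwise \<open>u\<close> lies in \<open>U\<close>, and maximality of \<open>K\<close> supplies
    the non-neighbour \<open>b\<close>.\<close>
  proof (cases "\<exists>a\<in>S. u \<rightarrow>\<^bsub>G\<^esub> a")
    case True
    then have "ends_induced_path S u" using S u unfolding greedy_set_def by blast
    then show ?thesis unfolding ends_induced_path_def by blast
  next
    case False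
    then have "u \<in> U - K" "a \<in> K" using u a by (auto simp: U_def)
    then obtain b where "b \<in> K" "\<not> u \<rightarrow>\<^bsub>G\<^esub> b" using max by blast
    moreover have "a \<rightarrow>\<^bsub>G\<^esub> b"
      using calculation \<open>a \<in> K\<close> a(2) K(2) unfolding clique_def by metis
    ultimately show ?thesis using \<open>a \<in> K\<close> a(2) u unfolding ends_induced_path_def by blast
  qed
  ultimately have "greedy_set (S \<union> K)" unfolding greedy_set_def by blast
  moreover have "S \<subset> S \<union> K" using K(1,3) unfolding U_def by blast
  ultimately show thesis by (rule that)
qed

text \<open>Any three vertices of the union lie in one member of the chain, and
  \<open>ends_induced_path\<close> is monotone in its set.\<close>

lemma greedy_set_Union_chain:
  assumes ch: "subset.chain (Collect greedy_set) C"
  shows "greedy_set (\<Union>C)"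
proof -
  have gr: "greedy_set S" if "S \<in> C" for S
    using ch that by (auto simp: subset_chain_def)
  have lin: "S \<subseteq> T \<or> T \<subseteq> S" if "S \<in> C" "T \<in> C" for S T
    using ch that by (auto simp: subset_chain_def)
  have "cluster_set (\<Union>C)"
    unfolding cluster_set_def
  proof (intro conjI ballI impI)
    show "\<Union>C \<subseteq> verts G" using gr unfolding greedy_set_def cluster_set_def by blast
  next
    fix x y z assume "x \<in> \<Union>C" "y \<in> \<Union>C" "z \<in> \<Union>C"
      and adj: "x \<rightarrow>\<^bsub>G\<^esub> y" "y \<rightarrow>\<^bsub>G\<^esub> z" "x \<noteq> z"
    then obtain X Y Z where "X \<in> C" "Y \<in> C" "Z \<in> C" "x \<in> X" "y \<in> Y" "z \<in> Z" by blast
    then obtain S where "S \<in> C" "x \<in> S" "y \<in> S" "z \<in> S"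
      using lin[of X Y] lin[of X Z] lin[of Y Z] by blast
    then show "x \<rightarrow>\<^bsub>G\<^esub> z"
      using gr adj unfolding greedy_set_def cluster_set_def by blast
  qed
  moreover have "ends_induced_path (\<Union>C) u"
    if u: "u \<in> verts G - \<Union>C" and a: "a \<in> \<Union>C" "u \<rightarrow>\<^bsub>G\<^esub> a" for u a
  proof -
    from a(1) obtain S where "S \<in> C" "a \<in> S" by blast
    then have "ends_induced_path S u" using gr u a(2) unfolding greedy_set_def by blast
    then show ?thesis using \<open>S \<in> C\<close> unfolding ends_induced_path_def by blast
  qed
  ultimately show ?thesis unfolding greedy_set_def by blast
qed

lemma exists_cluster_set_ends_induced_path:
  obtains S where "cluster_set S" "\<And>u. u \<in> verts G - S \<Longrightarrow> ends_induced_path S u"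
proof -
  have "\<exists>S\<in>Collect greedy_set. \<forall>X\<in>Collect greedy_set. S \<subseteq> X \<longrightarrow> X = S"
    \<comment> \<open>The empty chain is covered as well: its union, the empty set, satisfies
      \<open>greedy_set\<close> vacuously.\<close>
    by (rule subset_Zorn') (simp add: greedy_set_Union_chain)
  then obtain S where S: "greedy_set S"
    and max: "\<And>X. greedy_set X \<Longrightarrow> S \<subseteq> X \<Longrightarrow> X = S" by blast
  have "ends_induced_path S u" if u: "u \<in> verts G - S" for u
  proof -
    have "\<exists>a\<in>S. u \<rightarrow>\<^bsub>G\<^esub> a"
    proof (rule ccontr)
      assume "\<not> (\<exists>a\<in>S. u \<rightarrow>\<^bsub>G\<^esub> a)"
      then obtain T where "greedy_set T" "S \<subset> T"
        using greedy_set_extend[OF S u] by blast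
      then show False using max[of T] by blast
    qed
    then show ?thesis using S u unfolding greedy_set_def by blast
  qed
  then show thesis using that S unfolding greedy_set_def by blast
qed

section \<open>Distances, shortest paths and terminal sets\<close>

lemma graph_dist_le_length:
  "awalk u p v \<Longrightarrow> graph_dist u v \<le> ereal (real (length p))"
  using min_cost_le_walk_cost[of u p v "\<lambda>_. 1"]
  by (simp add: graph_dist_def awalk_cost_def sum_list_triv)

lemma adj_arc:
  assumes "u \<rightarrow>\<^bsub>G\<^esub> v"
  obtains e where "e \<in> arcs G" "tail G e = u" "head G e = v"
  using assms by (auto simp: arcs_ends_def arc_to_ends_def)

text \<open>The distance is an infimum over walks; a walk without arcs has equal ends, and one with
  a single arc has adjacent ends.\<close>

lemma graph_dist_ge_2:
  assumes "u \<noteq> v" "\<not> u \<rightarrow>\<^bsub>G\<^esub> v"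
  shows "2 \<le> graph_dist u v"
  unfolding graph_dist_def \<mu>_def
proof (rule INF_greatest, clarsimp)
  fix p assume p: "awalk u p v"
  have "p \<noteq> []" using p assms(1) by (auto simp: awalk_Nil_iff)
  moreover have "p \<noteq> [e]" for e
    using p assms(2) by (auto simp: awalk_Cons_iff awalk_Nil_iff in_arcs_imp_in_arcs_ends)
  ultimately have "2 \<le> length p"
    by (cases p; cases "tl p") auto
  then show "2 \<le> awalk_cost (\<lambda>_. 1) p"
    by (simp add: awalk_cost_def sum_list_triv)
qed

lemma induced_path_shortest_path:
  assumes "u \<rightarrow>\<^bsub>G\<^esub> a" "a \<rightarrow>\<^bsub>G\<^esub> b" "u \<noteq> b" "\<not> u \<rightarrow>\<^bsub>G\<^esub> b"
  obtains p where "shortest_path u p b" "set (awalk_verts u p) = {u, a, b}"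
proof -
  obtain e where e: "e \<in> arcs G" "tail G e = u" "head G e = a"
    using assms(1) by (rule adj_arc)
  obtain f where f: "f \<in> arcs G" "tail G f = a" "head G f = b"
    using assms(2) by (rule adj_arc)
  have ne: "u \<noteq> a" "a \<noteq> b" using assms adj_irrefl by blast+
  have w: "awalk u [e, f] b" using e f by (auto simp: awalk_Cons_iff awalk_Nil_iff)
  have "apath u [e, f] b" using w e f ne assms(3) by (simp add: apath_def)
  moreover have "graph_dist u b = 2"
    using graph_dist_ge_2[OF assms(3,4)] graph_dist_le_length[OF w] by (intro antisym) simp_all
  ultimately have "shortest_path u [e, f] b" by (simp add: shortest_path_def)
  moreover have "set (awalk_verts u [e, f]) = {u, a, b}" using e f by auto
  ultimately show thesis by (rule that)
qed

text \<open>A shortest path meeting \<open>S\<close> in three vertices has exactly two arcs and lies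
  inside \<open>S\<close>. Transitivity of adjacency on \<open>S\<close> then joins its ends by an
  arc, so it was not shortest.\<close>

lemma cluster_set_general_position:
  assumes diam: "graph_diameter \<le> 2" and S: "cluster_set S"
  shows "general_position S"
  unfolding general_position_def
proof (intro conjI notI)
  show "S \<subseteq> verts G" using S by (simp add: cluster_set_def)
next
  assume "\<exists>u p v. shortest_path u p v \<and> 3 \<le> card (S \<inter> set (awalk_verts u p))"
  then obtain u p v where w: "awalk u p v" and dist: "ereal (real (length p)) = graph_dist u v"
    and card: "3 \<le> card (S \<inter> set (awalk_verts u p))"
    by (auto simp: shortest_path_def apath_def)
  have "graph_dist u v \<le> graph_diameter"
    unfolding graph_diameter_def using w
    by (intro SUP_upper2[of "(u, v)"]) auto
  also note diam
  finally have le: "length p \<le> 2" using dist[symmetric] by simp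
  \<comment> \<open>A walk lists one vertex more than it has arcs, so three distinct vertices
    require at least two arcs.\<close>
  have "3 \<le> card (set (awalk_verts u p))"
    using card card_mono[of "set (awalk_verts u p)" "S \<inter> set (awalk_verts u p)"] by simp
  also have "\<dots> \<le> length (awalk_verts u p)" by (rule card_length)
  also have "\<dots> = Suc (length p)" by (simp add: length_awalk_verts)
  finally have len: "length p = 2" using le by simp
  then obtain e f where p: "p = [e, f]" by (auto simp: length_Suc_conv numeral_2_eq_2)
  define a where "a = head G e"
  have vs: "set (awalk_verts u p) = {u, a, v}" and adj: "u \<rightarrow>\<^bsub>G\<^esub> a" "a \<rightarrow>\<^bsub>G\<^esub> v"
    using w by (auto simp: p a_def awalk_Cons_iff awalk_Nil_iff dest: in_arcs_imp_in_arcs_ends)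
  have c3: "card {u, a, v} \<le> 3" by (simp add: card_insert_if)
  have "S \<inter> {u, a, v} = {u, a, v}"
    using card c3 unfolding vs by (intro card_seteq) auto
  \<comment> \<open>Distinctness of the ends follows by counting: otherwise the path would have at
    most two vertices.\<close>
  moreover have "u \<noteq> v"
  proof
    assume "u = v"
    then have "card {u, a, v} \<le> 2" by (simp add: card_insert_if)
    then show False using card calculation unfolding vs by simp
  qed
  ultimately have "u \<rightarrow>\<^bsub>G\<^esub> v" using S adj unfolding cluster_set_def by blast
  then obtain g where "g \<in> arcs G" "tail G g = u" "head G g = v" by (rule adj_arc)
  then have "awalk u [g] v" by (auto simp: awalk_Cons_iff awalk_Nil_iff)
  then have "graph_dist u v \<le> ereal 1" using graph_dist_le_length[of u "[g]" v] by simp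
  then show False using dist[symmetric] len by simp
qed

text \<open>One path \<open>u, a, b\<close> per outside vertex \<open>u\<close> serves both
  requirements. It meets \<open>S\<close> in the two vertices \<open>a\<close> and \<open>b\<close>,
  and it meets any larger set containing \<open>S\<close> and \<open>u\<close> in three, which rules
  out general position.\<close>

lemma cluster_set_terminal_set:
  assumes diam: "graph_diameter \<le> 2" and S: "cluster_set S"
    and ends: "\<And>u. u \<in> verts G - S \<Longrightarrow> ends_induced_path S u"
  shows "terminal_set S"
proof -
  have path: "\<exists>p a b. shortest_path u p b \<and> set (awalk_verts u p) = {u, a, b} \<and>
      a \<in> S \<and> b \<in> S \<and> u \<noteq> a \<and> u \<noteq> b \<and> a \<noteq> b" if u: "u \<in> verts G - S" for u
  proof -
    obtain a b where ab: "a \<in> S" "b \<in> S" "u \<rightarrow>\<^bsub>G\<^esub> a" "a \<rightarrow>\<^bsub>G\<^esub> b" "u \<noteq> b" "\<not> u \<rightarrow>\<^bsub>G\<^esub> b"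
      using ends[OF u] unfolding ends_induced_path_def by blast
    obtain p where "shortest_path u p b" "set (awalk_verts u p) = {u, a, b}"
      using induced_path_shortest_path[OF ab(3-6)] .
    moreover have "u \<noteq> a" "a \<noteq> b" using ab adj_irrefl by blast+
    ultimately show ?thesis using ab by blast
  qed
  have "T = S" if T: "general_position T" "S \<subseteq> T" for T
  proof (rule ccontr)
    assume "T \<noteq> S"
    \<comment> \<open>A proper superset \<open>T\<close> in general position consists of vertices,
      so its extra element is one to which \<open>path\<close> applies.\<close>
    then obtain u where u: "u \<in> T" "u \<in> verts G - S"
      using T unfolding general_position_def by blast
    obtain p a b where p: "shortest_path u p b" "set (awalk_verts u p) = {u, a, b}"
      and ab: "a \<in> S" "b \<in> S" "u \<noteq> a" "u \<noteq> b" "a \<noteq> b"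
      using path[OF u(2)] by blast
    have "T \<inter> set (awalk_verts u p) = {u, a, b}" using p(2) ab T(2) u(1) by auto
    then have "3 \<le> card (T \<inter> set (awalk_verts u p))" using ab by simp
    then show False using T(1) p(1) unfolding general_position_def by blast
  qed
  moreover have "\<exists>p v. shortest_path u p v \<and> 2 \<le> card (S \<inter> set (awalk_verts u p))"
    if u: "u \<in> verts G - S" for u
  proof -
    obtain p a b where p: "shortest_path u p b" "set (awalk_verts u p) = {u, a, b}"
      and ab: "a \<in> S" "b \<in> S" "a \<noteq> b"
      using path[OF u] by blast
    have "S \<inter> set (awalk_verts u p) = {a, b}" using p(2) ab u by auto
    then show ?thesis using p(1) ab(3) by (intro exI[of _ p] exI[of _ b]) simp
  qed
  ultimately show ?thesis
    using cluster_set_general_position[OF diam S] unfolding terminal_set_def by blast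
qed

end

theorem theorem3p1:
  fixes G :: "('a, 'b) pre_digraph"
  assumes "simple_graph G"
    and "wf_digraph.graph_diameter G = 2"
  shows "\<exists>S. wf_digraph.terminal_set G S"
proof -
  interpret simple_graph G by fact
  obtain S where "cluster_set S" "\<And>u. u \<in> verts G - S \<Longrightarrow> ends_induced_path S u"
    using exists_cluster_set_ends_induced_path by blast
  then have "terminal_set S" using assms(2) by (intro cluster_set_terminal_set) simp_all
  then show ?thesis by blast
qed

end
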